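(* Let $F$ be a uniformly complete Archimedean vector lattice and let $e\in F_+$. The following are equivalent: (a) $e$ is self-majorizing; (b) $I_e$ is a projection band in $F$; (c) $I_e$ is a band in $F$; (d) $I_e$ is uniformly closed in $F$.
   Context: An ideal of a vector lattice $F$ is a linear subspace $E\subset F$ such that $|f|\le|e|$, $e\in E$, $f\in F$ imply $f\in E$. For $e\in F_+$, $I_e=\bigcup_{\alpha\ge0}\alpha[-e,e]$ is the ideal generated by $e$ (principal ideal), with the norm $\|\cdot\|_e$ being the Minkowski functional of $[-e,e]$. $F$ is uniformly complete if every $(I_e,\|\cdot\|_e)$, $e\in F_+$, is complete (equivalently, every $I_e$ is vector lattice isomorphic to $C(K)$ for some compact Hausdorff $K$). A set $L\subset F$ is uniformly closed if $L\cap I_f$ is $\|\cdot\|_f$-closed in $I_f$ for every $f\in F_+$. A band is an ideal that contains the supremum (in $F$) of any of its subsets whenever this supremum exists. An ideal $H$ is a projection band if $F=H+H^d$, where $H^d=\{f\in F:|f|\wedge|h|=0\text{ for all }h\in H\}$. An element $e\in F_+$ is self-majorizing if for every $f\in F_+$ there is $r>0$ such that $f\wedge ne\le re$ for every $n\in\mathbb{N}$. *)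

theory Defs
  imports "HOL-Analysis.Analysis" "HOL-Library.Lattice_Algebras" "HOL-Library.Lub_Glb"
begin

class vector_lattice = ordered_real_vector + lattice_ab_group_add_abs

class archimedean_vector_lattice = vector_lattice +
  assumes archimedean: "(\<And>n::nat. real n *\<^sub>R x \<le> y) \<Longrightarrow> x \<le> 0"

definition principal_ideal :: "'a::vector_lattice \<Rightarrow> 'a set"
  where "principal_ideal e = (\<Union>\<alpha>\<in>{0..}. (\<lambda>x. \<alpha> *\<^sub>R x) ` {- e..e})"

text \<open>
  The Minkowski functional of the order interval from \<open>- e\<close> to \<open>e\<close>. It is only meaningful
  on the ideal generated by \<open>e\<close>; outside of it the gauge set is empty, and the value is set
  to 0 because the locale \<^locale>\<open>Metric_space\<close> asks for nonnegativity on the whole type.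
\<close>

definition ideal_norm :: "'a::vector_lattice \<Rightarrow> 'a \<Rightarrow> real"
  where "ideal_norm e x =
    (if x \<in> principal_ideal e then Inf {\<alpha>. 0 \<le> \<alpha> \<and> x \<in> (\<lambda>y. \<alpha> *\<^sub>R y) ` {- e..e}} else 0)"

definition ideal_dist :: "'a::vector_lattice \<Rightarrow> 'a \<Rightarrow> 'a \<Rightarrow> real"
  where "ideal_dist e x y = ideal_norm e (x - y)"

definition uniformly_complete :: "'a::vector_lattice itself \<Rightarrow> bool"
  where "uniformly_complete _ \<longleftrightarrow>
    (\<forall>e::'a. 0 \<le> e \<longrightarrow> Metric_space.mcomplete (principal_ideal e) (ideal_dist e))"

definition uniformly_closed :: "'a::vector_lattice set \<Rightarrow> bool"
  where "uniformly_closed L \<longleftrightarrow>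
    (\<forall>f\<ge>0. closedin (Metric_space.mtopology (principal_ideal f) (ideal_dist f))
              (L \<inter> principal_ideal f))"

definition lattice_ideal :: "'a::vector_lattice set \<Rightarrow> bool"
  where "lattice_ideal E \<longleftrightarrow> subspace E \<and> (\<forall>e\<in>E. \<forall>f. \<bar>f\<bar> \<le> \<bar>e\<bar> \<longrightarrow> f \<in> E)"

definition band :: "'a::vector_lattice set \<Rightarrow> bool"
  where "band E \<longleftrightarrow> lattice_ideal E \<and> (\<forall>A s. A \<subseteq> E \<longrightarrow> isLub UNIV A s \<longrightarrow> s \<in> E)"

definition disjoint_complement :: "'a::vector_lattice set \<Rightarrow> 'a set"
  where "disjoint_complement H = {f. \<forall>h\<in>H. inf \<bar>f\<bar> \<bar>h\<bar> = 0}"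

definition projection_band :: "'a::vector_lattice set \<Rightarrow> bool"
  where "projection_band H \<longleftrightarrow>
    lattice_ideal H \<and> (UNIV :: 'a set) = {h + g |h g. h \<in> H \<and> g \<in> disjoint_complement H}"

definition self_majorizing :: "'a::vector_lattice \<Rightarrow> bool"
  where "self_majorizing e \<longleftrightarrow>
    0 \<le> e \<and> (\<forall>f\<ge>0. \<exists>r>0. \<forall>n::nat. inf f (real n *\<^sub>R e) \<le> r *\<^sub>R e)"

text \<open>The metric notions above are used on genuine metric spaces.\<close>

lemma image_scaleR_interval:
  fixes e :: "'a::vector_lattice"
  assumes "0 \<le> \<alpha>" "0 \<le> e"
  shows "x \<in> (\<lambda>y. \<alpha> *\<^sub>R y) ` {- e..e} \<longleftrightarrow> - (\<alpha> *\<^sub>R e) \<le> x \<and> x \<le> \<alpha> *\<^sub>R e"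
proof
  assume "x \<in> (\<lambda>y. \<alpha> *\<^sub>R y) ` {- e..e}"
  then obtain y where y: "x = \<alpha> *\<^sub>R y" "- e \<le> y" "y \<le> e"
    by (elim imageE) auto
  show "- (\<alpha> *\<^sub>R e) \<le> x \<and> x \<le> \<alpha> *\<^sub>R e"
    using scaleR_left_mono[OF y(2) assms(1)] scaleR_left_mono[OF y(3) assms(1)] y(1) by simp
next
  assume a: "- (\<alpha> *\<^sub>R e) \<le> x \<and> x \<le> \<alpha> *\<^sub>R e"
  show "x \<in> (\<lambda>y. \<alpha> *\<^sub>R y) ` {- e..e}"
  proof (cases "\<alpha> = 0")
    case True
    then have "x = 0" using a by auto
    then show ?thesis using True assms(2) by (auto intro!: image_eqI[where x = 0])
  next
    case False
    then have p: "0 \<le> inverse \<alpha>" using assms(1) by simp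
    have "inverse \<alpha> *\<^sub>R - (\<alpha> *\<^sub>R e) \<le> inverse \<alpha> *\<^sub>R x" "inverse \<alpha> *\<^sub>R x \<le> inverse \<alpha> *\<^sub>R (\<alpha> *\<^sub>R e)"
      using a p by (meson scaleR_left_mono)+
    then show ?thesis using False by (auto intro!: image_eqI[where x = "inverse \<alpha> *\<^sub>R x"])
  qed
qed

lemma Metric_space_principal_ideal:
  fixes e :: "'a::archimedean_vector_lattice"
  assumes e: "0 \<le> e"
  shows "Metric_space (principal_ideal e) (ideal_dist e)"
proof -
  define G where "G x = {\<alpha>::real. 0 \<le> \<alpha> \<and> - (\<alpha> *\<^sub>R e) \<le> x \<and> x \<le> \<alpha> *\<^sub>R e}" for x
  have set: "{\<alpha>. 0 \<le> \<alpha> \<and> x \<in> (\<lambda>y. \<alpha> *\<^sub>R y) ` {- e..e}} = G x" for x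
    using image_scaleR_interval[OF _ e] by (auto simp: G_def)
  have mem: "x \<in> principal_ideal e \<longleftrightarrow> G x \<noteq> {}" for x
    using set[of x] by (auto simp: principal_ideal_def)
  have nrm: "ideal_norm e x = (if G x \<noteq> {} then Inf (G x) else 0)" for x
    by (simp add: ideal_norm_def set mem)
  have bdd: "bdd_below (G x)" for x
    by (rule bdd_belowI[of _ 0]) (auto simp: G_def)
  have minus: "G (- x) = G x" for x
    by (auto simp: G_def minus_le_iff le_minus_iff)
  have add: "a + b \<in> G (x + y)" if "a \<in> G x" "b \<in> G y" for a b x y
  proof -
    have "- (a *\<^sub>R e) + - (b *\<^sub>R e) \<le> x + y" "x + y \<le> a *\<^sub>R e + b *\<^sub>R e"
      using that unfolding G_def mem_Collect_eq by (blast intro: add_mono)+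
    then show ?thesis using that by (auto simp: G_def scaleR_add_left)
  qed
  have up: "b \<in> G x" if "a \<in> G x" "a \<le> b" for a b x
  proof -
    have "a *\<^sub>R e \<le> b *\<^sub>R e" using that e by (intro scaleR_right_mono) auto
    then have "- (b *\<^sub>R e) \<le> - (a *\<^sub>R e)" "a *\<^sub>R e \<le> b *\<^sub>R e" by simp_all
    then show ?thesis using that unfolding G_def mem_Collect_eq by (meson order_trans)
  qed
  have diff: "G (x - y) \<noteq> {}" if "G x \<noteq> {}" "G y \<noteq> {}" for x y
    using that add[of _ x _ "- y"] minus[of y] by auto
  have nn: "0 \<le> ideal_norm e x" for x
    by (auto simp: nrm G_def intro!: cInf_greatest)
  have tri: "ideal_norm e (x + y) \<le> ideal_norm e x + ideal_norm e y"
    if ne: "G x \<noteq> {}" "G y \<noteq> {}" for x y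
  proof (rule field_le_epsilon)
    fix d :: real assume d: "0 < d"
    obtain a where a: "a \<in> G x" "a < Inf (G x) + d / 2"
      using cInf_lessD[OF ne(1), of "Inf (G x) + d / 2"] d by auto
    obtain b where b: "b \<in> G y" "b < Inf (G y) + d / 2"
      using cInf_lessD[OF ne(2), of "Inf (G y) + d / 2"] d by auto
    have "Inf (G (x + y)) \<le> a + b" using add[OF a(1) b(1)] bdd by (simp add: cInf_lower)
    then show "ideal_norm e (x + y) \<le> ideal_norm e x + ideal_norm e y + d"
      using a b ne add[OF a(1) b(1)] by (auto simp: nrm)
  qed
  have zero: "x = 0" if ne: "G x \<noteq> {}" and z: "ideal_norm e x = 0" for x
  proof -
    have inG: "1 / real (Suc n) \<in> G x" for n
    proof -
      have "Inf (G x) < 1 / real (Suc n)" using ne z by (simp add: nrm)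
      then obtain a where "a \<in> G x" "a < 1 / real (Suc n)" using cInf_lessD[OF ne] by blast
      then show ?thesis using up by auto
    qed
    have le: "u \<le> 0" if u: "\<And>n. u \<le> (1 / real (Suc n)) *\<^sub>R e" for u
    proof (rule archimedean)
      fix n show "real n *\<^sub>R u \<le> e"
      proof (cases n)
        case (Suc m)
        have "real (Suc m) *\<^sub>R u \<le> real (Suc m) *\<^sub>R ((1 / real (Suc m)) *\<^sub>R e)"
          by (rule scaleR_left_mono[OF u]) simp
        then show ?thesis using Suc by simp
      qed (simp add: e)
    qed
    have "x \<le> 0" by (rule le) (use inG in \<open>auto simp: G_def\<close>)
    moreover have "- x \<le> 0"
      by (rule le) (use inG in \<open>auto simp: G_def minus_le_iff[of x]\<close>)
    ultimately show ?thesis by simp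
  qed
  have G0: "0 \<in> G 0" by (simp add: G_def)
  have n0: "ideal_norm e 0 = 0"
    using cInf_lower[OF G0 bdd] nn[of 0] G0 by (auto simp: nrm split: if_splits)
  show ?thesis
  proof
    fix x y
    show "0 \<le> ideal_dist e x y" by (simp add: ideal_dist_def nn)
    show "ideal_dist e x y = ideal_dist e y x"
      using minus[of "x - y"] by (simp add: ideal_dist_def nrm)
  next
    fix x y assume "x \<in> principal_ideal e" "y \<in> principal_ideal e"
    then show "ideal_dist e x y = 0 \<longleftrightarrow> x = y"
      using zero[of "x - y"] diff[of x y] n0 by (auto simp: ideal_dist_def mem)
  next
    fix x y z assume "x \<in> principal_ideal e" "y \<in> principal_ideal e" "z \<in> principal_ideal e"
    then show "ideal_dist e x z \<le> ideal_dist e x y + ideal_dist e y z"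
      using tri[of "x - y" "y - z"] diff[of x y] diff[of y z]
      by (simp add: ideal_dist_def mem)
  qed
qed

end

theory Submission
  imports Defs
begin

text \<open>
  Write \<open>I\<close> for the ideal generated by \<open>e\<close>. The four conditions are proved in a cycle.

  If \<open>e\<close> is self-majorizing and \<open>f \<ge> 0\<close>, the increasing family of the \<open>f \<and> t e\<close> becomes stationary
  at some \<open>t = r\<close>. Its final value \<open>f \<and> r e\<close> lies in \<open>I\<close>, and the remainder \<open>f - f \<and> r e\<close> is
  disjoint from \<open>I\<close>, since anything below both the remainder and a multiple \<open>t e\<close> could be added to
  \<open>f \<and> r e\<close> without leaving \<open>f \<and> (r + t) e\<close> (\<open>self_majorizing_imp_projection_band\<close>). A projection
  band is a band, because the component of a supremum along the complement cannot contribute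
  (\<open>projection_band_imp_band\<close>). A band is uniformly closed, because a limit \<open>x\<close> of elements
  of the band, uniform relative to some \<open>f \<ge> 0\<close>, satisfies \<open>\<bar>x\<bar> = sup\<^sub>\<epsilon> (\<bar>x\<bar> - \<epsilon> f)\<^sup>+\<close>, where each term of the supremum is dominated by
  one of the approximants (\<open>band_imp_uniformly_closed\<close>); the Archimedean property
  guarantees that the supremum is not smaller than \<open>\<bar>x\<bar>\<close>.

  Uniform completeness enters in the step from uniform closedness to self-majorization. Given
  \<open>f \<ge> 0\<close>, the series \<open>\<Sum>k. 2\<^sup>-\<^sup>k (f \<and> 4\<^sup>k e)\<close> converges in the norm of the ideal generated by \<open>f\<close>.
  Its partial sums lie in \<open>I\<close>, hence so does its sum as \<open>I\<close> is uniformly closed; thus the sum is at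
  most \<open>r e\<close> for some \<open>r\<close>. In a representation by continuous functions with \<open>f = 1\<close> the series behaves
  like the square root of \<open>e\<close>, and a square root bounded by \<open>r e\<close> forces \<open>e\<close> to be bounded away from
  \<open>0\<close> on its support. In lattice terms: each summand gives
  \<open>f \<and> 4\<^sup>k e \<le> 2\<^sup>k r e\<close>, and as \<open>2\<^sup>k r \<le> 4\<^sup>k\<^sup>-\<^sup>1\<close> for large \<open>k\<close>, this says
  \<open>f \<and> 4\<^sup>k e \<le> f \<and> 4\<^sup>k\<^sup>-\<^sup>1 e\<close>, so the sequence of the \<open>f \<and> 4\<^sup>k e\<close> is eventually constant
  (\<open>uniformly_closed_imp_self_majorizing\<close>).
\<close>

section \<open>Principal ideals and their norms\<close>

lemma mem_principal_ideal_iff: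
  fixes e :: "'a::vector_lattice"
  assumes "0 \<le> e"
  shows "x \<in> principal_ideal e \<longleftrightarrow> (\<exists>\<alpha>\<ge>0. \<bar>x\<bar> \<le> \<alpha> *\<^sub>R e)"
proof -
  have "x \<in> principal_ideal e \<longleftrightarrow> (\<exists>\<alpha>\<ge>0. x \<in> (\<lambda>y. \<alpha> *\<^sub>R y) ` {- e..e})"
    by (auto simp: principal_ideal_def)
  also have "\<dots> \<longleftrightarrow> (\<exists>\<alpha>\<ge>0. \<bar>x\<bar> \<le> \<alpha> *\<^sub>R e)"
    using image_scaleR_interval[OF _ assms] by (metis abs_le_iff minus_le_iff)
  finally show ?thesis .
qed

lemma lattice_ideal_principal_ideal:
  fixes e :: "'a::vector_lattice"
  assumes e: "0 \<le> e"
  shows "lattice_ideal (principal_ideal e)"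
  unfolding lattice_ideal_def subspace_def
proof (intro conjI ballI allI impI)
  show "0 \<in> principal_ideal e"
    using e by (auto simp: mem_principal_ideal_iff intro: exI[of _ 0])
next
  fix x y assume "x \<in> principal_ideal e" "y \<in> principal_ideal e"
  then obtain a b where "0 \<le> a" "0 \<le> b" "\<bar>x\<bar> \<le> a *\<^sub>R e" "\<bar>y\<bar> \<le> b *\<^sub>R e"
    using e by (auto simp: mem_principal_ideal_iff)
  then have "\<bar>x + y\<bar> \<le> (a + b) *\<^sub>R e" "0 \<le> a + b"
    by (auto simp: scaleR_add_left intro: order_trans[OF abs_triangle_ineq] add_mono)
  then show "x + y \<in> principal_ideal e"
    using e by (auto simp: mem_principal_ideal_iff)
next
  fix c :: real and x assume "x \<in> principal_ideal e"
  then obtain a where a: "0 \<le> a" "\<bar>x\<bar> \<le> a *\<^sub>R e"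
    using e by (auto simp: mem_principal_ideal_iff)
  have "c *\<^sub>R x \<le> \<bar>c\<bar> *\<^sub>R \<bar>x\<bar>" for x :: 'a
  proof (cases "0 \<le> c")
    case True then show ?thesis by (simp add: scaleR_left_mono abs_ge_self)
  next
    case False
    then have "(- c) *\<^sub>R (- x) \<le> (- c) *\<^sub>R \<bar>x\<bar>" by (intro scaleR_left_mono abs_ge_minus_self) auto
    then show ?thesis using False by simp
  qed
  from this[of x] this[of "- x"] have "\<bar>c *\<^sub>R x\<bar> \<le> \<bar>c\<bar> *\<^sub>R \<bar>x\<bar>"
    by (simp add: abs_le_iff)
  also have "\<dots> \<le> \<bar>c\<bar> *\<^sub>R (a *\<^sub>R e)" by (rule scaleR_left_mono) (use a in auto)
  finally show "c *\<^sub>R x \<in> principal_ideal e"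
    using e a by (auto simp: mem_principal_ideal_iff intro!: exI[of _ "\<bar>c\<bar> * a"])
next
  fix x y assume "x \<in> principal_ideal e" "\<bar>y\<bar> \<le> \<bar>x\<bar>"
  then show "y \<in> principal_ideal e"
    using e by (meson mem_principal_ideal_iff order_trans)
qed

lemma lattice_idealD:
  assumes "lattice_ideal E"
  shows lattice_ideal_subspace: "subspace E"
    and lattice_ideal_solid: "x \<in> E \<Longrightarrow> \<bar>y\<bar> \<le> \<bar>x\<bar> \<Longrightarrow> y \<in> E"
  using assms by (auto simp: lattice_ideal_def)

lemma ideal_dist_le:
  fixes f :: "'a::vector_lattice"
  assumes f: "0 \<le> f" and "0 \<le> \<alpha>" "\<bar>x - y\<bar> \<le> \<alpha> *\<^sub>R f"
  shows "ideal_dist f x y \<le> \<alpha>"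
proof -
  have "x - y \<in> principal_ideal f" using assms by (auto simp: mem_principal_ideal_iff)
  moreover have "\<alpha> \<in> {\<alpha>. 0 \<le> \<alpha> \<and> x - y \<in> (\<lambda>z. \<alpha> *\<^sub>R z) ` {- f..f}}"
    using assms image_scaleR_interval[of \<alpha> f "x - y"] by (auto simp: abs_le_iff minus_le_iff)
  then have "Inf {\<alpha>. 0 \<le> \<alpha> \<and> x - y \<in> (\<lambda>z. \<alpha> *\<^sub>R z) ` {- f..f}} \<le> \<alpha>"
    by (intro cInf_lower bdd_belowI[of _ 0]) auto
  ultimately show ?thesis by (simp add: ideal_dist_def ideal_norm_def)
qed

lemma abs_diff_le_of_ideal_dist_less:
  fixes f :: "'a::vector_lattice"
  assumes f: "0 \<le> f" and mem: "x \<in> principal_ideal f" "y \<in> principal_ideal f"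
    and less: "ideal_dist f x y < \<alpha>"
  shows "\<bar>x - y\<bar> \<le> \<alpha> *\<^sub>R f"
proof -
  let ?G = "{\<alpha>. 0 \<le> \<alpha> \<and> x - y \<in> (\<lambda>z. \<alpha> *\<^sub>R z) ` {- f..f}}"
  have xy: "x - y \<in> principal_ideal f"
    using mem lattice_ideal_subspace[OF lattice_ideal_principal_ideal[OF f]]
    by (simp add: subspace_diff)
  then have "?G \<noteq> {}" by (auto simp: principal_ideal_def)
  moreover have "Inf ?G < \<alpha>" using less xy by (simp add: ideal_dist_def ideal_norm_def)
  ultimately obtain b where "b \<in> ?G" "b < \<alpha>" by (meson cInf_lessD)
  then have "\<bar>x - y\<bar> \<le> b *\<^sub>R f" "b < \<alpha>"
    using image_scaleR_interval[of b f "x - y"] f by (auto simp: abs_le_iff minus_le_iff)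
  then show ?thesis using scaleR_right_mono[of b \<alpha> f] f by (meson less_imp_le order_trans)
qed

lemma le_zero_of_le_small_multiples:
  fixes f :: "'a::archimedean_vector_lattice"
  assumes "0 \<le> f" and le: "\<And>\<epsilon>. 0 < \<epsilon> \<Longrightarrow> x \<le> \<epsilon> *\<^sub>R f"
  shows "x \<le> 0"
proof (rule archimedean)
  fix n :: nat
  show "real n *\<^sub>R x \<le> f"
  proof (cases "n = 0")
    case False
    then have "real n *\<^sub>R x \<le> real n *\<^sub>R ((1 / real n) *\<^sub>R f)"
      by (intro scaleR_left_mono le) auto
    then show ?thesis using False by simp
  qed (simp add: assms)
qed

section \<open>Projection bands and bands\<close>

lemma inf_add_le_inf_add_inf:
  fixes a b c :: "'a::lattice_ab_group_add"
  assumes "0 \<le> a" "0 \<le> b" "0 \<le> c"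
  shows "inf (a + b) c \<le> inf a c + inf b c"
proof -
  have "inf a c + inf b c = inf (inf (a + b) (c + b)) (inf (a + c) (c + c))"
    by (simp add: add_inf_distrib_left add_inf_distrib_right)
  moreover have "c \<le> c + b" "c \<le> a + c" "c \<le> c + c" using assms by simp_all
  ultimately show ?thesis by (simp add: le_infI2)
qed

lemma disjoint_complement_add:
  fixes g h :: "'a::vector_lattice"
  assumes "g \<in> disjoint_complement H" "h \<in> disjoint_complement H"
  shows "g + h \<in> disjoint_complement H"
  unfolding disjoint_complement_def
proof safe
  fix y assume "y \<in> H"
  then have z: "inf \<bar>g\<bar> \<bar>y\<bar> = 0" "inf \<bar>h\<bar> \<bar>y\<bar> = 0"
    using assms by (auto simp: disjoint_complement_def)
  have "inf \<bar>g + h\<bar> \<bar>y\<bar> \<le> inf (\<bar>g\<bar> + \<bar>h\<bar>) \<bar>y\<bar>"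
    by (intro inf_mono abs_triangle_ineq order_refl)
  also have "\<dots> \<le> inf \<bar>g\<bar> \<bar>y\<bar> + inf \<bar>h\<bar> \<bar>y\<bar>"
    by (intro inf_add_le_inf_add_inf) auto
  finally have "inf \<bar>g + h\<bar> \<bar>y\<bar> \<le> 0" using z by simp
  then show "inf \<bar>g + h\<bar> \<bar>y\<bar> = 0" by (simp add: antisym)
qed

lemma disjoint_complement_uminus:
  "g \<in> disjoint_complement H \<Longrightarrow> - g \<in> disjoint_complement H"
  by (simp add: disjoint_complement_def)

text \<open>
  It suffices to decompose positive elements, since the positive and the negative part of an
  element can be treated separately.
\<close>

lemma projection_bandI:
  fixes H :: "'a::vector_lattice set"
  assumes H: "lattice_ideal H"
    and dec: "\<And>f. 0 \<le> f \<Longrightarrow> \<exists>h\<in>H. f - h \<in> disjoint_complement H"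
  shows "projection_band H"
proof -
  have "\<exists>h g. f = h + g \<and> h \<in> H \<and> g \<in> disjoint_complement H" for f
  proof -
    obtain h where h: "h \<in> H" "pprt f - h \<in> disjoint_complement H"
      using dec[of "pprt f"] by auto
    obtain k where k: "k \<in> H" "- nprt f - k \<in> disjoint_complement H"
      using dec[of "- nprt f"] by auto
    have "f = (h - k) + ((pprt f - h) + - (- nprt f - k))"
      using prts[of f] by (simp add: algebra_simps)
    moreover have "h - k \<in> H"
      using h k lattice_ideal_subspace[OF H] by (simp add: subspace_diff)
    ultimately show ?thesis
      using h k disjoint_complement_add disjoint_complement_uminus by blast
  qed
  then show ?thesis using H unfolding projection_band_def by blast
qed

text \<open>
  Once the family of all \<open>f \<and> t e\<close> has reached its largest member \<open>h = f \<and> r e\<close>, the rest \<open>f - h\<close>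
  has nothing in common with any \<open>t e\<close>: adding \<open>(f - h) \<and> t e\<close> to \<open>h\<close> yields an element that is
  below \<open>f\<close> and below \<open>(r + t) e\<close>, hence still below \<open>h\<close>.
\<close>

lemma self_majorizing_imp_projection_band:
  fixes e :: "'a::vector_lattice"
  assumes sm: "self_majorizing e"
  shows "projection_band (principal_ideal e)"
proof (rule projection_bandI)
  have e: "0 \<le> e" using sm by (simp add: self_majorizing_def)
  show "lattice_ideal (principal_ideal e)" by (rule lattice_ideal_principal_ideal[OF e])
  fix f :: 'a assume f: "0 \<le> f"
  obtain r where r: "r > 0" "\<And>n::nat. inf f (real n *\<^sub>R e) \<le> r *\<^sub>R e"
    using sm f by (auto simp: self_majorizing_def)
  define h where "h = inf f (r *\<^sub>R e)"
  have re: "0 \<le> r *\<^sub>R e" using r e by (simp add: scaleR_nonneg_nonneg)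
  then have h: "0 \<le> h" "h \<le> f" "h \<le> r *\<^sub>R e" using f by (auto simp: h_def)
  have max: "inf f (t *\<^sub>R e) \<le> h" for t
  proof -
    have "t *\<^sub>R e \<le> real (nat \<lceil>t\<rceil>) *\<^sub>R e" by (intro scaleR_right_mono e) linarith
    then have "inf f (t *\<^sub>R e) \<le> inf f (real (nat \<lceil>t\<rceil>) *\<^sub>R e)" by (intro inf_mono) auto
    also have "\<dots> \<le> r *\<^sub>R e" by (rule r)
    finally show ?thesis by (simp add: h_def)
  qed
  have "f - h \<in> disjoint_complement (principal_ideal e)"
    unfolding disjoint_complement_def
  proof safe
    fix y assume "y \<in> principal_ideal e"
    then obtain t where t: "0 \<le> t" "\<bar>y\<bar> \<le> t *\<^sub>R e"
      using e by (auto simp: mem_principal_ideal_iff)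
    define u where "u = inf (f - h) (t *\<^sub>R e)"
    have u: "u \<le> f - h" "u \<le> t *\<^sub>R e" by (simp_all add: u_def)
    have "h + u \<le> f" using u(1) by (simp add: algebra_simps)
    moreover have "h + u \<le> (r + t) *\<^sub>R e" using add_mono[OF h(3) u(2)] by (simp add: scaleR_add_left)
    ultimately have "h + u \<le> h" using max[of "r + t"] by (meson le_inf_iff order_trans)
    then have "u \<le> 0" by simp
    moreover have "inf \<bar>f - h\<bar> \<bar>y\<bar> \<le> u"
      using t h by (auto simp: u_def intro: le_infI2)
    ultimately have "inf \<bar>f - h\<bar> \<bar>y\<bar> \<le> 0" by simp
    then show "inf \<bar>f - h\<bar> \<bar>y\<bar> = 0" by (simp add: antisym)
  qed
  moreover have "h \<in> principal_ideal e"
    using h r e by (auto simp: mem_principal_ideal_iff intro!: exI[of _ r])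
  ultimately show "\<exists>h\<in>principal_ideal e. f - h \<in> disjoint_complement (principal_ideal e)" by blast
qed

text \<open>
  Let \<open>s = h + g\<close> be the decomposition of a supremum of elements \<open>a\<close> of \<open>H\<close>. The positive part of
  \<open>a - h \<le> g\<close> belongs to \<open>H\<close> and is dominated by \<open>\<bar>g\<bar>\<close>, which is
  disjoint from \<open>H\<close>, so it vanishes; thus \<open>h\<close> already is an
  upper bound.
\<close>

lemma projection_band_imp_band:
  fixes H :: "'a::vector_lattice set"
  assumes pb: "projection_band H"
  shows "band H"
  unfolding band_def
proof (intro conjI allI impI)
  show H: "lattice_ideal H" using pb by (simp add: projection_band_def)
  fix A s assume A: "A \<subseteq> H" and s: "isLub UNIV A s"
  obtain h g where hg: "s = h + g" "h \<in> H" "g \<in> disjoint_complement H"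
    using pb unfolding projection_band_def by blast
  have upper: "a \<le> h" if a: "a \<in> A" for a
  proof -
    let ?p = "pprt (a - h)"
    have "a - h \<in> H"
      using a A hg lattice_ideal_subspace[OF H] by (auto intro: subspace_diff)
    moreover have "?p \<le> \<bar>a - h\<bar>" by (simp add: pprt_def abs_ge_self)
    ultimately have "?p \<in> H" using lattice_ideal_solid[OF H, of "a - h" ?p] by simp
    then have "inf \<bar>g\<bar> \<bar>?p\<bar> = 0" using hg by (auto simp: disjoint_complement_def)
    moreover have "a - h \<le> g" using isLubD2[OF s a] hg by (simp add: algebra_simps)
    then have "?p \<le> \<bar>g\<bar>" by (simp add: pprt_def) (meson abs_ge_self order_trans)
    ultimately have "?p = 0" by (simp add: inf.absorb2)
    then have "a - h \<le> 0" by (simp only: le_zero_iff_zero_pprt)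
    then show ?thesis by simp
  qed
  then have "isUb UNIV A h" by (simp add: isUb_def setle_def)
  then have "s \<le> h" by (rule isLub_le_isUb[OF s])
  then have neg: "g \<le> 0" using hg by simp
  show "s \<in> H"
  proof (cases "A = {}")
    case True
    \<comment> \<open>The supremum of the empty set is a least element, and a vector lattice has one only if it is trivial.\<close>
    then have least: "s \<le> x" for x
      by (intro isLub_le_isUb[OF s]) (simp add: isUb_def setle_def)
    have "0 \<le> s" using least[of "s + s"] by simp
    then have "s = 0" using least[of 0] by simp
    then show ?thesis using lattice_ideal_subspace[OF H] by (simp add: subspace_0)
  next
    case False
    then obtain a where a: "a \<in> A" by auto
    \<comment> \<open>Now \<open>a - h \<le> g \<le> 0\<close>, so \<open>g\<close> lies in \<open>H\<close> by solidity.\<close>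
    have "a - h \<le> g" using isLubD2[OF s a] hg by (simp add: algebra_simps)
    then have "\<bar>g\<bar> \<le> \<bar>a - h\<bar>" using neg upper[OF a] by (simp add: algebra_simps)
    moreover have "a - h \<in> H"
      using a A hg lattice_ideal_subspace[OF H] by (auto intro: subspace_diff)
    ultimately have "g \<in> H" using lattice_ideal_solid[OF H] by blast
    then show ?thesis using hg lattice_ideal_subspace[OF H] by (auto intro: subspace_add)
  qed
qed

section \<open>Uniform closedness\<close>

text \<open>
  The elements \<open>(\<bar>x\<bar> - \<epsilon> f)\<^sup>+\<close> are dominated by the approximants, and their supremum is \<open>\<bar>x\<bar>\<close> by the
  Archimedean property.
\<close>

lemma band_contains_uniform_limits:
  fixes H :: "'a::archimedean_vector_lattice set"
  assumes H: "band H" and f: "0 \<le> f"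
    and approx: "\<And>\<epsilon>. 0 < \<epsilon> \<Longrightarrow> \<exists>y\<in>H. \<bar>x - y\<bar> \<le> \<epsilon> *\<^sub>R f"
  shows "x \<in> H"
proof -
  have ideal: "lattice_ideal H" using H by (simp add: band_def)
  define A where "A = (\<lambda>\<epsilon>. pprt (\<bar>x\<bar> - \<epsilon> *\<^sub>R f)) ` {0<..}"
  have "A \<subseteq> H"
  proof
    fix a assume "a \<in> A"
    then obtain \<epsilon> where \<epsilon>: "0 < \<epsilon>" and a: "a = pprt (\<bar>x\<bar> - \<epsilon> *\<^sub>R f)" by (auto simp: A_def)
    obtain y where y: "y \<in> H" "\<bar>x - y\<bar> \<le> \<epsilon> *\<^sub>R f" using approx[OF \<epsilon>] by auto
    have "\<bar>x\<bar> \<le> \<bar>x - y\<bar> + \<bar>y\<bar>" using abs_triangle_ineq[of "x - y" y] by simp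
    also have "\<dots> \<le> \<epsilon> *\<^sub>R f + \<bar>y\<bar>" using y by simp
    finally have "a \<le> \<bar>y\<bar>" unfolding a by (simp add: pprt_def algebra_simps)
    then show "a \<in> H" using y lattice_ideal_solid[OF ideal, of y a] by (simp add: a)
  qed
  moreover have "isLub UNIV A \<bar>x\<bar>"
  proof (rule isLubI2)
    show "isUb UNIV A \<bar>x\<bar>"
      using f by (auto intro!: isUbI setleI simp: A_def pprt_def scaleR_nonneg_nonneg)
    show "\<bar>x\<bar> <=* Collect (isUb UNIV A)"
    proof (rule setgeI, clarify)
      fix b assume b: "isUb UNIV A b"
      have "\<bar>x\<bar> - b \<le> 0"
      proof (rule le_zero_of_le_small_multiples[OF f])
        fix \<epsilon> :: real assume "0 < \<epsilon>"
        then have "pprt (\<bar>x\<bar> - \<epsilon> *\<^sub>R f) \<le> b" by (intro isUbD[OF b]) (auto simp: A_def)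
        then show "\<bar>x\<bar> - b \<le> \<epsilon> *\<^sub>R f" by (simp add: pprt_def algebra_simps)
      qed
      then show "\<bar>x\<bar> \<le> b" by simp
    qed
  qed
  ultimately have "\<bar>x\<bar> \<in> H" using H by (auto simp: band_def)
  then show ?thesis using lattice_ideal_solid[OF ideal, of "\<bar>x\<bar>" x] by simp
qed

lemma band_imp_uniformly_closed:
  fixes H :: "'a::archimedean_vector_lattice set"
  assumes H: "band H"
  shows "uniformly_closed H"
  unfolding uniformly_closed_def
proof (intro allI impI)
  fix f :: 'a assume f: "0 \<le> f"
  interpret Metric_space "principal_ideal f" "ideal_dist f"
    by (rule Metric_space_principal_ideal[OF f])
  show "closedin mtopology (H \<inter> principal_ideal f)"
    unfolding metric_closedin_iff_sequentially_closed
  proof (intro conjI allI impI; (elim conjE)?)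
    fix \<sigma> l
    assume \<sigma>: "range \<sigma> \<subseteq> H \<inter> principal_ideal f" and lim: "limitin mtopology \<sigma> l sequentially"
    have l: "l \<in> principal_ideal f" using lim limit_metric_sequentially by blast
    have "l \<in> H"
    proof (rule band_contains_uniform_limits[OF H f])
      fix \<epsilon> :: real assume "0 < \<epsilon>"
      then obtain n where "ideal_dist f (\<sigma> n) l < \<epsilon>"
        using lim unfolding limit_metric_sequentially by blast
      moreover have "\<sigma> n \<in> H" "\<sigma> n \<in> principal_ideal f" using \<sigma> by auto
      ultimately show "\<exists>y\<in>H. \<bar>l - y\<bar> \<le> \<epsilon> *\<^sub>R f"
        using abs_diff_le_of_ideal_dist_less[OF f _ l] by (metis abs_minus_commute)
    qed
    then show "l \<in> H \<inter> principal_ideal f" using l by simp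
  qed simp
qed

text \<open>
  The element \<open>g\<close> is the sum of the \<open>2\<^sup>-\<^sup>k b k\<close>: the partial sums form a Cauchy sequence in the norm of
  the ideal generated by \<open>f\<close>, and \<open>L\<close> contains their limit. Since the terms are positive, the sum
  dominates each of them.
\<close>

lemma uniformly_closed_dominates_geometric_series:
  fixes L :: "'a::archimedean_vector_lattice set"
  assumes complete: "uniformly_complete TYPE('a)"
    and L: "uniformly_closed L" "subspace L"
    and f: "0 \<le> f"
    and b: "\<And>k. 0 \<le> b k" "\<And>k. b k \<le> f" "\<And>k. b k \<in> L"
  shows "\<exists>g\<in>L. \<forall>k. (1 / 2 ^ k) *\<^sub>R b k \<le> g"
proof -
  interpret Metric_space "principal_ideal f" "ideal_dist f"
    by (rule Metric_space_principal_ideal[OF f])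
  define s where "s n = (\<Sum>k<n. (1 / 2 ^ k) *\<^sub>R b k)" for n :: nat
  have term_nonneg: "0 \<le> (1 / 2 ^ k) *\<^sub>R b k" for k
    using b by (simp add: scaleR_nonneg_nonneg)
  have mono: "s m \<le> s n" if "m \<le> n" for m n
    using that unfolding s_def by (intro sum_mono2 term_nonneg) auto
  have tail: "s n - s m \<le> (2 / 2 ^ m - 2 / 2 ^ n) *\<^sub>R f" if "m \<le> n" for m n
    using that
  proof (induction n rule: dec_induct)
    case (step n)
    have "s (Suc n) - s m = (s n - s m) + (1 / 2 ^ n) *\<^sub>R b n" by (simp add: s_def)
    also have "\<dots> \<le> (2 / 2 ^ m - 2 / 2 ^ n) *\<^sub>R f + (1 / 2 ^ n) *\<^sub>R f"
      by (intro add_mono step.IH scaleR_left_mono b) auto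
    also have "\<dots> = (2 / 2 ^ m - 2 / 2 ^ Suc n) *\<^sub>R f"
      by (simp add: scaleR_add_left[symmetric])
    finally show ?case .
  qed simp
  have dist: "\<bar>s n - s m\<bar> \<le> (2 / 2 ^ N) *\<^sub>R f" if "N \<le> m" "N \<le> n" for N m n
  proof -
    have *: "\<bar>s n - s m\<bar> \<le> (2 / 2 ^ N) *\<^sub>R f" if "N \<le> m" "m \<le> n" for m n
    proof -
      have "\<bar>s n - s m\<bar> = s n - s m" using mono[OF \<open>m \<le> n\<close>] by simp
      also have "\<dots> \<le> (2 / 2 ^ m - 2 / 2 ^ n) *\<^sub>R f" by (rule tail[OF \<open>m \<le> n\<close>])
      also have "\<dots> \<le> (2 / 2 ^ N) *\<^sub>R f"
      proof (rule scaleR_right_mono[OF _ f])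
        have "2 / 2 ^ m \<le> (2 / 2 ^ N :: real)"
          using \<open>N \<le> m\<close> by (intro divide_left_mono power_increasing) auto
        moreover have "0 \<le> (2 / 2 ^ n :: real)" by simp
        ultimately show "2 / 2 ^ m - 2 / 2 ^ n \<le> (2 / 2 ^ N :: real)" by linarith
      qed
      finally show ?thesis .
    qed
    show ?thesis using *[of m n] *[of n m] that by (metis abs_minus_commute nat_le_linear)
  qed
  have sL: "s n \<in> L" for n
    unfolding s_def using L b by (intro subspace_sum subspace_scale)
  have sI: "s n \<in> principal_ideal f" for n
    using dist[of 0 0 n] f by (auto simp: mem_principal_ideal_iff s_def intro!: exI[of _ 2])
  have "MCauchy s"
    unfolding MCauchy_def
  proof (intro conjI allI impI)
    show "range s \<subseteq> principal_ideal f" using sI by auto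
    fix \<epsilon> :: real assume \<epsilon>: "0 < \<epsilon>"
    obtain N where N: "(1 / 2) ^ N < \<epsilon> / 2" using real_arch_pow_inv[of "\<epsilon> / 2" "1 / 2"] \<epsilon> by auto
    then have small: "2 / 2 ^ N < \<epsilon>" by (simp add: power_one_over field_simps)
    have "ideal_dist f (s n) (s n') < \<epsilon>" if "N \<le> n" "N \<le> n'" for n n'
      using ideal_dist_le[OF f _ dist[OF that(2,1)]] small by simp
    then show "\<exists>N. \<forall>n n'. N \<le> n \<longrightarrow> N \<le> n' \<longrightarrow> ideal_dist f (s n) (s n') < \<epsilon>"
      by blast
  qed
  moreover have "mcomplete" using complete f by (simp add: uniformly_complete_def)
  ultimately obtain g where g: "limitin mtopology s g sequentially"
    by (auto simp: mcomplete_def)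
  have gI: "g \<in> principal_ideal f" using g limit_metric_sequentially by blast
  have "closedin mtopology (L \<inter> principal_ideal f)"
    using L f by (simp add: uniformly_closed_def)
  then have gL: "g \<in> L"
    using g sL sI unfolding metric_closedin_iff_sequentially_closed by blast
  have s_le: "s n \<le> g" for n
  proof -
    have "s n - g \<le> 0"
    proof (rule le_zero_of_le_small_multiples[OF f])
      fix \<epsilon> :: real assume "0 < \<epsilon>"
      then obtain N where N: "\<And>m. N \<le> m \<Longrightarrow> ideal_dist f (s m) g < \<epsilon>"
        using g unfolding limit_metric_sequentially by blast
      define m where "m = max N n"
      have "s n - g \<le> s m - g" using mono[of n m] by (simp add: m_def)
      also have "\<dots> \<le> \<bar>s m - g\<bar>" by (rule abs_ge_self)
      also have "\<dots> \<le> \<epsilon> *\<^sub>R f"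
        by (intro abs_diff_le_of_ideal_dist_less f sI gI N) (simp add: m_def)
      finally show "s n - g \<le> \<epsilon> *\<^sub>R f" .
    qed
    then show ?thesis by simp
  qed
  have "(1 / 2 ^ k) *\<^sub>R b k \<le> g" for k
  proof -
    have "(1 / 2 ^ k) *\<^sub>R b k \<le> s k + (1 / 2 ^ k) *\<^sub>R b k"
      using mono[of 0 k] by (simp add: s_def)
    also have "\<dots> = s (Suc k)" by (simp add: s_def)
    also have "\<dots> \<le> g" by (rule s_le)
    finally show ?thesis .
  qed
  then show ?thesis using gL by blast
qed

text \<open>
  The weights \<open>2\<^sup>-\<^sup>k\<close> make the series of the \<open>f \<and> 4\<^sup>k e\<close> converge, while they decay slowly enough for
  a bound of the sum by a multiple of \<open>e\<close> to improve the trivial estimate \<open>f \<and> 4\<^sup>k e \<le> 4\<^sup>k e\<close>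
  by any factor.
\<close>

lemma uniformly_closed_imp_self_majorizing:
  fixes e :: "'a::archimedean_vector_lattice"
  assumes complete: "uniformly_complete TYPE('a)" and e: "0 \<le> e"
    and closed: "uniformly_closed (principal_ideal e)"
  shows "self_majorizing e"
  unfolding self_majorizing_def
proof (intro conjI allI impI e)
  fix f :: 'a assume f: "0 \<le> f"
  define b where "b k = inf f ((4 ^ k :: real) *\<^sub>R e)" for k :: nat
  have b_nonneg: "0 \<le> b k" and b_le: "b k \<le> f" "b k \<le> 4 ^ k *\<^sub>R e" for k
    using f e by (auto simp: b_def scaleR_nonneg_nonneg)
  have "b k \<in> principal_ideal e" for k
    using b_nonneg[of k] b_le(2)[of k] e by (auto simp: mem_principal_ideal_iff intro!: exI[of _ "4 ^ k"])
  then obtain g where g: "g \<in> principal_ideal e" "\<And>k. (1 / 2 ^ k) *\<^sub>R b k \<le> g"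
    using uniformly_closed_dominates_geometric_series[OF complete closed _ f, of b]
      lattice_ideal_subspace[OF lattice_ideal_principal_ideal[OF e]] b_nonneg b_le(1) by blast
  obtain r where r: "0 \<le> r" "\<bar>g\<bar> \<le> r *\<^sub>R e" using g(1) e by (auto simp: mem_principal_ideal_iff)
  obtain j where j: "r < 2 ^ j" using real_arch_pow[of 2 r] by auto
  have improved: "b k \<le> 2 ^ (k + j) *\<^sub>R e" for k
  proof -
    have "(1 / 2 ^ k) *\<^sub>R b k \<le> r *\<^sub>R e" using g(2) r(2) by (meson abs_ge_self order_trans)
    also have "\<dots> \<le> 2 ^ j *\<^sub>R e" using j e by (intro scaleR_right_mono) auto
    finally have "(2 ^ k :: real) *\<^sub>R ((1 / 2 ^ k) *\<^sub>R b k) \<le> (2 ^ k :: real) *\<^sub>R (2 ^ j *\<^sub>R e)"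
      by (intro scaleR_left_mono) auto
    then show ?thesis by (simp add: power_add)
  qed
  \<comment> \<open>For \<open>k \<ge> j + 2\<close> one has \<open>k + j \<le> 2 (k - 1)\<close>, so the improved bound is at most \<open>4\<^sup>k\<^sup>-\<^sup>1 e\<close>.\<close>
  have stationary: "b k \<le> b (j + 1)" if "j + 1 \<le> k" for k
    using that
  proof (induction k rule: dec_induct)
    case (step k)
    have "(2::real) ^ (Suc k + j) \<le> 2 ^ (2 * k)" using step.hyps by (intro power_increasing) auto
    also have "\<dots> = 4 ^ k" by (simp add: power_mult)
    finally have "(2::real) ^ (Suc k + j) *\<^sub>R e \<le> 4 ^ k *\<^sub>R e" using e by (rule scaleR_right_mono)
    then have "b (Suc k) \<le> 4 ^ k *\<^sub>R e" using improved[of "Suc k"] by (rule order_trans[rotated])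
    then have "b (Suc k) \<le> b k" using b_le(1)[of "Suc k"] by (simp add: b_def[of k])
    then show ?case using step.IH by simp
  qed simp
  show "\<exists>r>0. \<forall>n::nat. inf f (real n *\<^sub>R e) \<le> r *\<^sub>R e"
  proof (intro exI[of _ "4 ^ (j + 1)"] conjI allI)
    fix n :: nat
    define k where "k = n + (j + 1)"
    have "n \<le> 4 ^ n" by (rule less_imp_le[OF less_exp[THEN less_le_trans]]) (simp add: power_mono)
    also have "\<dots> \<le> (4::nat) ^ k" by (rule power_increasing) (auto simp: k_def)
    finally have "real n \<le> real (4 ^ k)" by (rule of_nat_mono)
    then have "real n *\<^sub>R e \<le> 4 ^ k *\<^sub>R e" using e by (intro scaleR_right_mono) auto
    then have "inf f (real n *\<^sub>R e) \<le> b k" unfolding b_def by (intro inf_mono) auto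
    also have "\<dots> \<le> b (j + 1)" by (rule stationary) (simp add: k_def)
    also have "\<dots> \<le> 4 ^ (j + 1) *\<^sub>R e" by (rule b_le)
    finally show "inf f (real n *\<^sub>R e) \<le> 4 ^ (j + 1) *\<^sub>R e" .
  qed simp
qed

theorem corollary3p20:
  fixes e :: "'a::archimedean_vector_lattice"
  assumes "uniformly_complete TYPE('a)" and "0 \<le> e"
  shows "(self_majorizing e \<longleftrightarrow> projection_band (principal_ideal e)) \<and>
    (projection_band (principal_ideal e) \<longleftrightarrow> band (principal_ideal e)) \<and>
    (band (principal_ideal e) \<longleftrightarrow> uniformly_closed (principal_ideal e))"
  using self_majorizing_imp_projection_band projection_band_imp_band band_imp_uniformly_closed
    uniformly_closed_imp_self_majorizing[OF assms] by blast

end
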